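(* Let $k\ge 1$ and let $1\le s_1<s_2<\ldots<s_k$ be fixed integers. For each integer $n>s_k$, let $f_{G}(n)$ be the number of rooted spanning forests in the circulant graph $G=C_{2n}(s_1,s_2,\ldots,s_k,n)$. Denote by $p$ the number of odd elements in the sequence $s_1,s_2,\ldots,s_k$. Let $q$ and $r$ be the square-free parts of $4p+1$ and $4p+3$ respectively. Then there exists an integer sequence $a(n)$ such that (1) $f_{G}(n)=q\,a(n)^2$ if $n$ is even; (2) $f_{G}(n)=r\,a(n)^2$ if $n$ is odd.
   Context: The circulant graph $C_{m}(t_1,\ldots,t_l)$ (with $1\le t_1<\ldots<t_l\le \frac m2$) is the simple undirected graph with vertices $0,1,\ldots,m-1$ in which each vertex $i$ is adjacent to the vertices $i\pm t_1,\ldots,i\pm t_l \pmod m$. In particular, in $C_{2n}(s_1,\ldots,s_k,n)$ each vertex $i$ is adjacent to $i\pm s_1,\ldots,i\pm s_k$ and, by a single edge, to $i+n \pmod{2n}$, so every vertex has degree $2k+1$. A rooted spanning forest of a graph is a spanning acyclic subgraph (containing all the vertices) together with a choice of one distinguished vertex (root) in each connected component. Any positive integer $m$ can be uniquely written as $m=q\,r^2$ with $q,r$ positive integers and $q$ square-free; $q$ is called the square-free part of $m$. *)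

theory Defs
  imports "HOL-Analysis.Analysis" "HOL-Computational_Algebra.Computational_Algebra"
begin

text \<open>
  A simple undirected graph is given by its vertex set and its edge set, an edge being
  the two-element set of its end points.
\<close>

type_synonym 'a ugraph = "'a set \<times> 'a set set"

abbreviation verts :: "'a ugraph \<Rightarrow> 'a set" where
  "verts G \<equiv> fst G"

abbreviation edges :: "'a ugraph \<Rightarrow> 'a set set" where
  "edges G \<equiv> snd G"

text \<open>
  The edges at \<open>i\<close> are those to \<open>i + t\<close> and \<open>i - t\<close> modulo \<open>m\<close>; the latter arise because
  edges are unordered. For \<open>t = m / 2\<close> the two coincide, giving a single edge.
  The intended range is \<open>1 \<le> t \<le> m / 2\<close> for all \<open>t \<in> T\<close>.
\<close>

definition circulant_graph :: "nat \<Rightarrow> nat set \<Rightarrow> nat ugraph" where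
  "circulant_graph m T = ({..<m}, {{i, (i + t) mod m} | i t. i < m \<and> t \<in> T})"

text \<open>
  A cycle is listed without repeating its first vertex at the end. Length at least 3
  excludes traversing a single edge back and forth.
\<close>

definition is_cycle :: "'a ugraph \<Rightarrow> 'a list \<Rightarrow> bool" where
  "is_cycle G vs \<longleftrightarrow> 3 \<le> length vs \<and> distinct vs \<and>
     (\<forall>i<length vs. {vs ! i, vs ! (Suc i mod length vs)} \<in> edges G)"

definition acyclic_graph :: "'a ugraph \<Rightarrow> bool" where
  "acyclic_graph G \<longleftrightarrow> (\<nexists>vs. is_cycle G vs)"

definition connectivity :: "'a ugraph \<Rightarrow> 'a rel" where
  "connectivity G = {(u, v). u \<in> verts G \<and> v \<in> verts G \<and> (u, v) \<in> {(x, y). {x, y} \<in> edges G}\<^sup>*}"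

definition components_of_graph :: "'a ugraph \<Rightarrow> 'a set set" where
  "components_of_graph G = verts G // connectivity G"

text \<open>
  A rooted spanning forest is encoded by its edge set \<open>F\<close> and its set of roots \<open>R\<close>; its
  vertex set is that of the whole graph.
\<close>

definition rooted_spanning_forest :: "'a ugraph \<Rightarrow> 'a set set \<Rightarrow> 'a set \<Rightarrow> bool" where
  "rooted_spanning_forest G F R \<longleftrightarrow>
     F \<subseteq> edges G \<and> acyclic_graph (verts G, F) \<and>
     R \<subseteq> verts G \<and> (\<forall>C \<in> components_of_graph (verts G, F). \<exists>!r. r \<in> C \<and> r \<in> R)"

definition num_rooted_spanning_forests :: "'a ugraph \<Rightarrow> nat" where
  "num_rooted_spanning_forests G = card {(F, R). rooted_spanning_forest G F R}"

end

theory Submission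
  imports Defs "Jordan_Normal_Form.Determinant"
begin

text \<open>
  By the matrix forest theorem the number of rooted spanning forests of a graph is the determinant of
  the identity plus the Laplacian. It is proved here by expanding that determinant row by row: every
  row is a sum of the rows ``\<open>v\<close> is a root'' and ``\<open>v\<close> has the neighbour \<open>w\<close> as its parent'', so that
  the determinant is a sum over all ways to choose a parent for every vertex. A choice contributes
  1 if following parents always ends in a root, and 0 otherwise
  (\<open>det_parent_matrix_descending\<close>, \<open>det_parent_matrix_not_descending\<close>). The choices of the first kind
  are the rooted spanning forests with all edges directed towards the roots
  (\<open>num_rooted_spanning_forests_eq_card_parent_maps\<close>).

  For a circulant graph on \<open>2 * n\<close> vertices the matrix has the entries \<open>c (i - j)\<close> for an even
  function \<open>c\<close> with period \<open>2 * n\<close>. Its eigenvalue at a \<open>2 * n\<close>-th root of unity \<open>z\<close> equals the one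
  at \<open>1 / z\<close>, so the determinant is the product of the eigenvalues at 1 and -1 and of the square of a
  product over the roots of unity in the upper half plane. To see that this last product is an
  integer one can recognise it as the determinant of the integer matrix by which the circulant acts
  on odd functions. This is done without eigenvalues: the functionals ``sum'' and
  ``alternating sum'', the odd part \<open>g(i) - g(-i)\<close> and the odd part of \<open>g(i + 1) - g(i - 1)\<close> together
  determine \<open>g\<close>, and they intertwine the circulant with a block diagonal integer matrix in which the
  odd block occurs twice (\<open>det_circulant\<close>).

  The two remaining eigenvalues are the sum and the alternating sum of \<open>c\<close>. The former is 1 as the rows
  of a Laplacian sum to 0. The latter is one plus twice the number of connections of odd length at
  a vertex, which is \<open>4 * p + 1\<close> for even \<open>n\<close> and \<open>4 * p + 3\<close> for odd \<open>n\<close>, the edge to the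
  antipodal vertex having length \<open>n\<close>. Writing \<open>4 * p + 1\<close> as \<open>q\<close> times a square turns
  \<open>(4 * p + 1) * b\<^sup>2\<close> into \<open>q * a\<^sup>2\<close>, and likewise for \<open>4 * p + 3\<close> and \<open>r\<close>.
\<close>

unbundle no vec_syntax
hide_const (open) Determinants.det Finite_Cartesian_Product.mat
  Finite_Cartesian_Product.row Finite_Cartesian_Product.vec

section \<open>Rooted spanning forests as parent maps\<close>

text \<open>
  A rooted forest is stored as the map sending each vertex to its parent, and each root to itself.
  Such a map comes from a forest if iterating it always ends in a fixed point; a strictly
  decreasing rank is the form of this condition that lends itself to induction, and it makes no
  reference to a vertex set.
\<close>

definition descending :: "('a \<Rightarrow> 'a) \<Rightarrow> ('a \<Rightarrow> nat) \<Rightarrow> bool" where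
  "descending \<phi> d \<longleftrightarrow> (\<forall>v. \<phi> v \<noteq> v \<longrightarrow> d (\<phi> v) < d v)"

definition parent_edges :: "('a \<Rightarrow> 'a) \<Rightarrow> 'a set set" where
  "parent_edges \<phi> = {{v, \<phi> v} | v. \<phi> v \<noteq> v}"

text \<open>
  Fixing everything outside the graph makes a parent map determined by its values on the vertices.
\<close>

definition parent_maps :: "'a ugraph \<Rightarrow> ('a \<Rightarrow> 'a) set" where
  "parent_maps G = {\<phi>. parent_edges \<phi> \<subseteq> edges G \<and> (\<forall>v. v \<notin> verts G \<longrightarrow> \<phi> v = v) \<and>
                        (\<exists>d. descending \<phi> d)}"

definition proper_graph :: "'a ugraph \<Rightarrow> bool" where
  "proper_graph G \<longleftrightarrow> edges G \<subseteq> {{u, v} | u v. u \<in> verts G \<and> v \<in> verts G \<and> u \<noteq> v}"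

lemma proper_graphD:
  assumes "proper_graph G" "{u, v} \<in> edges G"
  shows "u \<in> verts G" "v \<in> verts G" "u \<noteq> v"
  using assms unfolding proper_graph_def by (auto simp: doubleton_eq_iff)

lemma in_parent_edges_iff:
  "{u, v} \<in> parent_edges \<phi> \<longleftrightarrow> u \<noteq> v \<and> (\<phi> u = v \<or> \<phi> v = u)"
  unfolding parent_edges_def by (auto simp: doubleton_eq_iff)

lemma descending_iterate_less:
  assumes d: "descending \<phi> d" and "i < j" "\<phi> ((\<phi> ^^ i) x) \<noteq> (\<phi> ^^ i) x"
  shows "d ((\<phi> ^^ j) x) < d ((\<phi> ^^ i) x)"
proof -
  have "d (\<phi> v) \<le> d v" for v
    using d by (cases "\<phi> v = v") (auto simp: descending_def)
  then have "d ((\<phi> ^^ j) x) \<le> d ((\<phi> ^^ Suc i) x)"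
    using \<open>i < j\<close> lift_Suc_antimono_le[of "\<lambda>m. d ((\<phi> ^^ m) x)" "Suc i" j] by simp
  also have "\<dots> < d ((\<phi> ^^ i) x)"
    using assms by (simp add: descending_def)
  finally show ?thesis .
qed

lemma fixed_iterate:
  assumes "\<phi> ((\<phi> ^^ i) x) = (\<phi> ^^ i) x" "i \<le> j"
  shows "(\<phi> ^^ j) x = (\<phi> ^^ i) x"
  using assms(2,1) by (induction rule: dec_induct) auto

lemma descending_reaches_fixpoint:
  assumes "descending \<phi> d"
  shows "\<phi> ((\<phi> ^^ d v) v) = (\<phi> ^^ d v) v"
proof (rule ccontr)
  assume ne: "\<not> ?thesis"
  have "d ((\<phi> ^^ i) v) + i \<le> d v" if "i \<le> Suc (d v)" for i
    using that
  proof (induction i)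
    case (Suc i)
    have "\<phi> ((\<phi> ^^ i) v) \<noteq> (\<phi> ^^ i) v"
      using ne Suc.prems fixed_iterate[of \<phi> i v "d v"] by auto
    then show ?case
      using Suc assms by (fastforce simp: descending_def)
  qed simp
  from this[of "Suc (d v)"] show False by simp
qed

text \<open>
  Following parents from \<open>v\<close> for \<open>d v\<close> steps reaches the root of \<open>v\<close>. The root is the invariant
  that separates the trees: it is the same for a vertex and its parent.
\<close>

lemma obtain_root_map:
  assumes "descending \<phi> d"
  obtains \<rho> where "\<And>v. \<phi> (\<rho> v) = \<rho> v" "\<And>v. \<rho> (\<phi> v) = \<rho> v" "\<And>v. \<phi> v = v \<Longrightarrow> \<rho> v = v"
    "\<And>v. \<exists>m. \<rho> v = (\<phi> ^^ m) v"
proof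
  let ?\<rho> = "\<lambda>v. (\<phi> ^^ d v) v"
  show fp: "\<phi> (?\<rho> v) = ?\<rho> v" for v
    using descending_reaches_fixpoint[OF assms] .
  show "?\<rho> (\<phi> v) = ?\<rho> v" for v
  proof (cases "\<phi> v = v")
    case False
    then have "d (\<phi> v) < d v" using assms by (auto simp: descending_def)
    then have "(\<phi> ^^ (d v - 1)) (\<phi> v) = ?\<rho> (\<phi> v)"
      using fp[of "\<phi> v"] by (intro fixed_iterate) auto
    moreover have "(\<phi> ^^ (d v - 1)) (\<phi> v) = ?\<rho> v"
      using \<open>d (\<phi> v) < d v\<close> by (metis Suc_pred' funpow_simps_right(2) less_nat_zero_code neq0_conv o_apply)
    ultimately show ?thesis by simp
  qed simp
  show "\<phi> v = v \<Longrightarrow> ?\<rho> v = v" for v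
    using fixed_iterate[of \<phi> 0 v "d v"] by simp
  show "\<exists>m. ?\<rho> v = (\<phi> ^^ m) v" for v by blast
qed

lemma ex1_root_iff:
  assumes "R \<subseteq> V"
  shows "(\<forall>C \<in> components_of_graph (V, F). \<exists>!r. r \<in> C \<and> r \<in> R) \<longleftrightarrow>
         (\<forall>v \<in> V. \<exists>!r. r \<in> R \<and> (v, r) \<in> {(x, y). {x, y} \<in> F}\<^sup>*)"
proof -
  have "(r \<in> connectivity (V, F) `` {v} \<and> r \<in> R) \<longleftrightarrow> (r \<in> R \<and> (v, r) \<in> {(x, y). {x, y} \<in> F}\<^sup>*)"
    if "v \<in> V" for r v
    using that assms by (auto simp: connectivity_def)
  then show ?thesis
    by (simp add: components_of_graph_def quotient_def)
qed

text \<open>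
  On a cycle, both neighbours of a vertex of maximal rank must be its parent.
\<close>

lemma acyclic_parent_edges:
  assumes "descending \<phi> d"
  shows "acyclic_graph (V, parent_edges \<phi>)"
  unfolding acyclic_graph_def
proof
  assume "\<exists>vs. is_cycle (V, parent_edges \<phi>) vs"
  then obtain vs where len: "3 \<le> length vs" and dist: "distinct vs"
    and cyc: "\<And>i. i < length vs \<Longrightarrow> {vs ! i, vs ! (Suc i mod length vs)} \<in> parent_edges \<phi>"
    by (auto simp: is_cycle_def)
  let ?l = "length vs"
  have pos: "0 < ?l" using len by linarith
  then have "0 \<in> {..<?l}" by blast
  then have "{..<?l} \<noteq> {}" by blast
  then obtain i where "i \<in> {..<?l}" and max: "\<And>j. j \<in> {..<?l} \<Longrightarrow> d (vs ! j) \<le> d (vs ! i)"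
    using obtains_MAX[of "{..<?l}" "\<lambda>i. d (vs ! i)"] Max_ge[of "(\<lambda>i. d (vs ! i)) ` {..<?l}"]
    by (metis finite_imageI finite_lessThan image_eqI)
  then have i: "i < ?l" and mx: "\<And>j. j < ?l \<Longrightarrow> d (vs ! j) \<le> d (vs ! i)" by auto
  have nb: "\<phi> (vs ! i) = vs ! j" if "j < ?l" "{vs ! i, vs ! j} \<in> parent_edges \<phi>" for j
    using that mx[of j] assms[unfolded descending_def, rule_format, of "vs ! j"]
    by (auto simp: in_parent_edges_iff)
  define j k where "j = Suc i mod ?l" and "k = (if i = 0 then ?l - 1 else i - 1)"
  have jk: "j < ?l" "k < ?l" "Suc k mod ?l = i"
    using len i mod_less_divisor[OF pos] by (auto simp: j_def k_def)
  have "\<phi> (vs ! i) = vs ! j" using nb[OF jk(1)] cyc[OF i] by (simp add: j_def)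
  moreover have "\<phi> (vs ! i) = vs ! k" using nb[OF jk(2)] cyc[OF jk(2)] jk(3) by (simp add: insert_commute)
  ultimately have "j = k" using dist jk by (metis nth_eq_iff_index_eq)
  then show False
    using len i by (auto simp: j_def k_def mod_Suc split: if_splits)
qed

lemma rooted_spanning_forest_of_parent_map:
  assumes G: "proper_graph G" and \<phi>: "\<phi> \<in> parent_maps G"
  shows "rooted_spanning_forest G (parent_edges \<phi>) {v \<in> verts G. \<phi> v = v}"
proof -
  from \<phi> obtain d where d: "descending \<phi> d" and E: "parent_edges \<phi> \<subseteq> edges G"
    and out: "\<And>v. v \<notin> verts G \<Longrightarrow> \<phi> v = v"
    by (auto simp: parent_maps_def)
  let ?A = "{(x, y). {x, y} \<in> parent_edges \<phi>}"
  obtain \<rho> where \<rho>: "\<And>v. \<phi> (\<rho> v) = \<rho> v" "\<And>v. \<rho> (\<phi> v) = \<rho> v" "\<And>v. \<phi> v = v \<Longrightarrow> \<rho> v = v"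
    "\<And>v. \<exists>m. \<rho> v = (\<phi> ^^ m) v"
    using obtain_root_map[OF d] by metis
  have inV: "\<phi> v \<in> verts G" if "v \<in> verts G" for v
    using that G E proper_graphD[of G v "\<phi> v"] by (cases "\<phi> v = v") (auto simp: parent_edges_def)
  have itV: "(\<phi> ^^ m) v \<in> verts G \<and> (v, (\<phi> ^^ m) v) \<in> ?A\<^sup>*" if "v \<in> verts G" for v m
  proof (induction m)
    case (Suc m)
    show ?case
    proof (cases "\<phi> ((\<phi> ^^ m) v) = (\<phi> ^^ m) v")
      case False
      then have "((\<phi> ^^ m) v, \<phi> ((\<phi> ^^ m) v)) \<in> ?A" by (simp add: in_parent_edges_iff)
      then show ?thesis using Suc inV by (auto intro: rtrancl_into_rtrancl)
    qed (use Suc in simp)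
  qed (use that in simp)
  have const: "\<rho> v = \<rho> w" if "(v, w) \<in> ?A\<^sup>*" for v w
    using that
  proof induction
    case (step y z)
    then have "\<phi> y = z \<or> \<phi> z = y" by (simp add: in_parent_edges_iff)
    then show ?case using step.IH \<rho>(2)[of y] \<rho>(2)[of z] by auto
  qed simp
  have "\<exists>!r. r \<in> {v \<in> verts G. \<phi> v = v} \<and> (v, r) \<in> ?A\<^sup>*" if "v \<in> verts G" for v
  proof (rule ex1I[of _ "\<rho> v"])
    show "\<rho> v \<in> {v \<in> verts G. \<phi> v = v} \<and> (v, \<rho> v) \<in> ?A\<^sup>*"
      using \<rho>(1,4) itV[OF that] by (metis (mono_tags, lifting) mem_Collect_eq)
    show "r = \<rho> v" if "r \<in> {v \<in> verts G. \<phi> v = v} \<and> (v, r) \<in> ?A\<^sup>*" for r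
      using that const \<rho>(3) by auto
  qed
  then show ?thesis
    unfolding rooted_spanning_forest_def
    using acyclic_parent_edges[OF d] E by (subst ex1_root_iff) auto
qed

text \<open>
  If an edge from \<open>v\<close> to its \<open>\<phi>\<close>-parent were directed the other way by \<open>\<psi>\<close>, then so would be the
  next edge on the \<open>\<phi>\<close>-path, and so on up to the root; but \<open>\<psi>\<close> fixes the root as well.
\<close>

lemma parent_map_unique:
  assumes "descending \<phi> d" "descending \<psi> e"
    and E: "parent_edges \<phi> = parent_edges \<psi>"
    and R: "\<And>v. \<phi> v = v \<longleftrightarrow> \<psi> v = v"
  shows "\<phi> = \<psi>"
proof -
  have no: False if "\<phi> v \<noteq> v" "\<psi> (\<phi> v) = v" for v
    using that
  proof (induction "d v" arbitrary: v rule: less_induct)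
    case less
    let ?w = "\<phi> v"
    have dw: "d ?w < d v" using less.prems assms(1) by (auto simp: descending_def)
    have nf: "\<phi> ?w \<noteq> ?w" using R less.prems by metis
    then have "{?w, \<phi> ?w} \<in> parent_edges \<psi>" unfolding E[symmetric] by (auto simp: in_parent_edges_iff)
    then consider "\<psi> ?w = \<phi> ?w" | "\<psi> (\<phi> ?w) = ?w" by (auto simp: in_parent_edges_iff)
    then show False
    proof cases
      case 1
      then have "\<phi> ?w = v" using less.prems by simp
      then show False using dw nf assms(1) by (auto simp: descending_def) (metis not_less_iff_gr_or_eq)
    next
      case 2
      then show False using less.hyps[OF dw nf] by blast
    qed
  qed
  show ?thesis
  proof
    fix v
    show "\<phi> v = \<psi> v"
    proof (cases "\<phi> v = v")
      case False
      then have "{v, \<phi> v} \<in> parent_edges \<psi>" unfolding E[symmetric] by (auto simp: in_parent_edges_iff)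
      then show ?thesis using no[OF False] by (auto simp: in_parent_edges_iff)
    qed (use R in metis)
  qed
qed

text \<open>
  The \<open>\<phi>\<close>-paths from \<open>u\<close> and \<open>v\<close> to their first common vertex, together with the edge between \<open>u\<close>
  and \<open>v\<close>, form a cycle. The two inequalities on parents ensure that it has at least three vertices.
\<close>

lemma chord_closes_cycle:
  assumes d: "descending \<phi> d" and \<rho>: "(\<phi> ^^ a0) u = (\<phi> ^^ b0) v"
    and F: "parent_edges \<phi> \<subseteq> F" "{u, v} \<in> F"
    and ne: "u \<noteq> v" "\<phi> u \<noteq> v" "\<phi> v \<noteq> u"
  shows "\<not> acyclic_graph (V, F)"
proof -
  define a where "a = (LEAST a. \<exists>b. (\<phi> ^^ a) u = (\<phi> ^^ b) v)"
  have exb: "\<exists>b. (\<phi> ^^ a) u = (\<phi> ^^ b) v"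
    unfolding a_def by (rule LeastI[of _ a0]) (use \<rho> in blast)
  have mina: "(\<phi> ^^ i) u \<noteq> (\<phi> ^^ j) v" if "i < a" for i j
    using not_less_Least[OF that[unfolded a_def]] by blast
  define b where "b = (LEAST b. (\<phi> ^^ a) u = (\<phi> ^^ b) v)"
  have ab: "(\<phi> ^^ a) u = (\<phi> ^^ b) v"
    unfolding b_def using exb by (rule LeastI_ex)
  have minb: "(\<phi> ^^ a) u \<noteq> (\<phi> ^^ j) v" if "j < b" for j
    using not_less_Least[OF that[unfolded b_def]] .
  have nfu: "\<phi> ((\<phi> ^^ i) u) \<noteq> (\<phi> ^^ i) u" if "i < a" for i
    using fixed_iterate[of \<phi> i u a] mina[OF that, of b] ab that by auto
  have nfv: "\<phi> ((\<phi> ^^ i) v) \<noteq> (\<phi> ^^ i) v" if "i < b" for i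
    using fixed_iterate[of \<phi> i v b] minb[OF that] ab that by auto
  \<comment> \<open>The cycle runs up from \<open>u\<close> to the meeting point, at index \<open>a\<close>, and back down to \<open>v\<close>.\<close>
  define w where "w i = (if i \<le> a then (\<phi> ^^ i) u else (\<phi> ^^ (a + b - i)) v)" for i
  have w_ge: "w i = (\<phi> ^^ (a + b - i)) v" if "a \<le> i" for i
    using that ab by (cases "i = a") (auto simp: w_def)
  define vs where "vs = map w [0..<Suc (a + b)]"
  have ne_less: "w i \<noteq> w j" if "i < j" "j \<le> a + b" for i j
  proof -
    consider "j \<le> a" | "i \<le> a" "a < j" | "a < i" using \<open>i < j\<close> by linarith
    then show ?thesis
    proof cases
      case 1
      then show ?thesis
        using descending_iterate_less[OF d that(1) nfu[of i]] that by (auto simp: w_def)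
    next
      case 2
      then show ?thesis
        using mina[of i] minb[of "a + b - j"] that by (cases "i = a") (auto simp: w_def)
    next
      case 3
      then have "a + b - j < a + b - i" "a + b - j < b" using that by linarith+
      then show ?thesis
        using descending_iterate_less[OF d _ nfv[of "a + b - j"], of "a + b - i"] 3 that
        by (auto simp: w_def)
    qed
  qed
  have "distinct vs"
    unfolding vs_def distinct_map
  proof (intro conjI distinct_upt inj_onI)
    fix i j assume "i \<in> set [0..<Suc (a + b)]" "j \<in> set [0..<Suc (a + b)]" "w i = w j"
    then show "i = j" using ne_less[of i j] ne_less[of j i] by (auto simp: less_Suc_eq_le) (metis nat_neq_iff)
  qed
  moreover have "3 \<le> length vs"
  proof (rule ccontr)
    assume "\<not> ?thesis"
    then consider "a = 0" "b = 0" | "a = 1" "b = 0" | "a = 0" "b = 1"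
      by (auto simp: vs_def) linarith
    then show False using ab ne by cases auto
  qed
  moreover have "{vs ! i, vs ! (Suc i mod length vs)} \<in> F" if i: "i < length vs" for i
  proof -
    consider "i < a" | "a \<le> i" "i < a + b" | "i = a + b"
      using i unfolding vs_def length_map length_upt by linarith
    then show ?thesis
    proof cases
      case 1
      then have "{w i, w (Suc i)} \<in> parent_edges \<phi>"
        using nfu[of i] by (auto simp: w_def in_parent_edges_iff)
      then show ?thesis using 1 F by (auto simp: vs_def simp del: upt_Suc)
    next
      case 2
      then have "a + b - i = Suc (a + b - Suc i)" by simp
      then have "{w i, w (Suc i)} \<in> parent_edges \<phi>"
        using 2 nfv[of "a + b - Suc i"] by (auto simp: w_ge in_parent_edges_iff)
      then show ?thesis using 2 F by (auto simp: vs_def simp del: upt_Suc)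
    next
      case 3
      then have "vs ! i = v" "vs ! (Suc i mod length vs) = u"
        by (auto simp: vs_def w_ge w_def[of 0] simp del: upt_Suc)
      then show ?thesis using F by (simp add: insert_commute)
    qed
  qed
  ultimately show ?thesis
    unfolding acyclic_graph_def is_cycle_def by auto
qed

text \<open>
  The parent of a vertex is a neighbour closer to the roots. No edge of the forest is lost: the end
  points of an edge have the same root, so an edge outside the parent map would close a cycle.
\<close>

lemma parent_map_of_rooted_spanning_forest:
  assumes G: "proper_graph G" and rsf: "rooted_spanning_forest G F R"
  shows "\<exists>\<phi> \<in> parent_maps G. parent_edges \<phi> = F \<and> {v \<in> verts G. \<phi> v = v} = R"
proof -
  let ?V = "verts G" and ?A = "{(x, y). {x, y} \<in> F}"
  have FE: "F \<subseteq> edges G" and ac: "acyclic_graph (?V, F)" and RV: "R \<subseteq> ?V"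
    using rsf by (auto simp: rooted_spanning_forest_def)
  have ex1: "\<exists>!r. r \<in> R \<and> (v, r) \<in> ?A\<^sup>*" if "v \<in> ?V" for v
    using rsf that by (auto simp: rooted_spanning_forest_def ex1_root_iff[OF RV])
  define d where "d v = (LEAST m. \<exists>r \<in> R. (v, r) \<in> ?A ^^ m)" for v
  have dI: "\<exists>r \<in> R. (v, r) \<in> ?A ^^ d v" if "v \<in> ?V" for v
    unfolding d_def by (rule LeastI_ex) (use ex1[OF that] rtrancl_imp_relpow in blast)
  have closer: "\<exists>w. {v, w} \<in> F \<and> d w < d v" if v: "v \<in> ?V - R" for v
  proof -
    obtain r where r: "r \<in> R" "(v, r) \<in> ?A ^^ d v" using dI v by blast
    then obtain m where m: "d v = Suc m" using v by (cases "d v") auto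
    then obtain w where w: "(v, w) \<in> ?A" "(w, r) \<in> ?A ^^ m"
      using r by (metis relpow_Suc_D2)
    then have "d w \<le> m" unfolding d_def using r by (intro Least_le) blast
    then show ?thesis using w m by auto
  qed
  define \<phi> where "\<phi> v = (if v \<in> ?V - R then SOME w. {v, w} \<in> F \<and> d w < d v else v)" for v
  have \<phi>: "{v, \<phi> v} \<in> F" "d (\<phi> v) < d v" if "v \<in> ?V - R" for v
    using someI_ex[OF closer[OF that]] that by (auto simp: \<phi>_def)
  have desc: "descending \<phi> d"
    using \<phi>(2) unfolding descending_def by (metis \<phi>_def)
  have fixed: "\<phi> v = v \<longleftrightarrow> v \<notin> ?V - R" for v
    using \<phi>(2)[of v] by (auto simp: \<phi>_def)
  have sub: "parent_edges \<phi> \<subseteq> F"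
    using \<phi>(1) fixed by (auto simp: parent_edges_def)
  have pm: "\<phi> \<in> parent_maps G"
    using desc sub FE fixed by (auto simp: parent_maps_def)
  obtain \<rho> where \<rho>: "\<And>v. \<phi> (\<rho> v) = \<rho> v" "\<And>v. \<exists>m. \<rho> v = (\<phi> ^^ m) v"
    using obtain_root_map[OF desc] by metis
  have \<rho>R: "\<rho> v \<in> R \<and> (v, \<rho> v) \<in> ?A\<^sup>*" if v: "v \<in> ?V" for v
  proof -
    have "(\<phi> ^^ m) v \<in> ?V \<and> (v, (\<phi> ^^ m) v) \<in> ?A\<^sup>*" for m
    proof (induction m)
      case (Suc m)
      show ?case
      proof (cases "(\<phi> ^^ m) v \<in> ?V - R")
        case True
        then show ?thesis
          using \<phi>(1)[OF True] Suc FE proper_graphD(2)[OF G] by (auto intro: rtrancl_into_rtrancl)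
      next
        case False
        then show ?thesis using Suc fixed[of "(\<phi> ^^ m) v"] by simp
      qed
    qed (use v in simp)
    then show ?thesis using \<rho>[of v] fixed[of "\<rho> v"] by (metis DiffI)
  qed
  have "F \<subseteq> parent_edges \<phi>"
  proof
    fix e assume e: "e \<in> F"
    then obtain u v where uv: "e = {u, v}" "u \<in> ?V" "v \<in> ?V" "u \<noteq> v"
      using FE G unfolding proper_graph_def by blast
    have "(u, v) \<in> ?A" using e uv by simp
    then have "(u, \<rho> v) \<in> ?A\<^sup>*" using \<rho>R[OF uv(3)] by (meson converse_rtrancl_into_rtrancl)
    then have "\<rho> u = \<rho> v" using ex1[OF uv(2)] \<rho>R[OF uv(2)] \<rho>R[OF uv(3)] by blast
    then obtain a b where "(\<phi> ^^ a) u = (\<phi> ^^ b) v" using \<rho>(2) by metis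
    then show "e \<in> parent_edges \<phi>"
      using chord_closes_cycle[OF desc _ sub, of a u b v ?V] e uv ac by (auto simp: in_parent_edges_iff)
  qed
  then show ?thesis using pm sub fixed RV by (intro bexI[of _ \<phi>]) auto
qed

theorem num_rooted_spanning_forests_eq_card_parent_maps:
  assumes G: "proper_graph G"
  shows "num_rooted_spanning_forests G = card (parent_maps G)"
proof -
  let ?h = "\<lambda>\<phi>. (parent_edges \<phi>, {v \<in> verts G. \<phi> v = v})"
  have "bij_betw ?h (parent_maps G) {(F, R). rooted_spanning_forest G F R}"
  proof (rule bij_betw_imageI)
    show "inj_on ?h (parent_maps G)"
    proof (rule inj_onI)
      fix \<phi> \<psi> assume a: "\<phi> \<in> parent_maps G" "\<psi> \<in> parent_maps G" "?h \<phi> = ?h \<psi>"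
      then obtain d e where "descending \<phi> d" "descending \<psi> e" by (auto simp: parent_maps_def)
      moreover have "\<phi> v = v \<longleftrightarrow> \<psi> v = v" for v
        using a by (cases "v \<in> verts G") (auto simp: parent_maps_def set_eq_iff)
      ultimately show "\<phi> = \<psi>" using a(3) parent_map_unique[of \<phi> d \<psi> e] by auto
    qed
    show "?h ` parent_maps G = {(F, R). rooted_spanning_forest G F R}"
      using rooted_spanning_forest_of_parent_map[OF G] parent_map_of_rooted_spanning_forest[OF G]
      by (force simp: image_iff)
  qed
  then show ?thesis
    unfolding num_rooted_spanning_forests_def using bij_betw_same_card by fastforce
qed

section \<open>The matrix forest theorem\<close>

text \<open>
  Row \<open>i\<close> says \<open>x i - x (\<phi> i)\<close>, or \<open>x i\<close> if \<open>i\<close> is a root.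
\<close>

definition parent_matrix :: "nat \<Rightarrow> (nat \<Rightarrow> nat) \<Rightarrow> int mat" where
  "parent_matrix n \<phi> = mat n n (\<lambda>(i, j). of_bool (i = j) - of_bool (\<phi> i \<noteq> i \<and> \<phi> i = j))"

text \<open>
  A permutation contributing to the Leibniz formula sends every vertex to itself or to its parent.
  It cannot move a vertex of minimal rank among those it moves, since the parent is already fixed.
\<close>

lemma det_parent_matrix_descending:
  assumes d: "descending \<phi> d"
  shows "det (parent_matrix n \<phi>) = 1"
proof -
  let ?M = "parent_matrix n \<phi>" and ?P = "{\<pi>. \<pi> permutes {0..<n}}"
  have M: "?M \<in> carrier_mat n n" by (simp add: parent_matrix_def)
  have zero: "(\<Prod>i = 0..<n. ?M $$ (i, \<pi> i)) = 0" if \<pi>: "\<pi> permutes {0..<n}" and "\<pi> \<noteq> id" for \<pi>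
  proof (rule ccontr)
    assume nz: "\<not> ?thesis"
    have \<pi>cases: "\<pi> i = i \<or> \<pi> i = \<phi> i" if "i < n" for i
    proof -
      have "?M $$ (i, \<pi> i) \<noteq> 0" using nz that by simp
      moreover have "\<pi> i < n" using permutes_in_image[OF \<pi>, of i] that by simp
      ultimately show ?thesis using that by (auto simp: parent_matrix_def split: if_splits)
    qed
    obtain i where "\<pi> i \<noteq> i" using \<open>\<pi> \<noteq> id\<close> by (auto simp: fun_eq_iff)
    then obtain i where i: "\<pi> i \<noteq> i" "\<And>j. d j < d i \<Longrightarrow> \<pi> j = j"
      using exists_least_iff[of "\<lambda>m. \<exists>i. d i = m \<and> \<pi> i \<noteq> i"] by metis
    then have "i < n" using permutes_not_in[OF \<pi>, of i] by auto
    then have "\<pi> i = \<phi> i" using \<pi>cases i(1) by blast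
    then have "\<pi> (\<phi> i) = \<pi> i" using i d by (simp add: descending_def)
    then show False using permutes_inj[OF \<pi>] \<open>\<pi> i = \<phi> i\<close> i(1) by (metis injD)
  qed
  have "det ?M = (\<Sum>\<pi> \<in> ?P. signof \<pi> * (\<Prod>i = 0..<n. ?M $$ (i, \<pi> i)))"
    by (rule det_def'[OF M])
  also have "\<dots> = (\<Sum>\<pi> \<in> {id}. signof \<pi> * (\<Prod>i = 0..<n. ?M $$ (i, \<pi> i)))"
    by (rule sum.mono_neutral_right) (use zero in \<open>auto simp: permutes_id finite_permutations\<close>)
  also have "\<dots> = (\<Prod>i = 0..<n. ?M $$ (i, i))" by simp
  also have "\<dots> = 1" by (intro prod.neutral) (auto simp: parent_matrix_def)
  finally show ?thesis .
qed

text \<open>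
  The set of vertices from which no root is reached is nonempty, contains no root, and contains
  a vertex if and only if it contains its parent, so its indicator vector lies in the kernel.
\<close>

lemma det_parent_matrix_not_descending:
  assumes \<phi>: "\<And>i. i < n \<Longrightarrow> \<phi> i < n" "\<And>i. n \<le> i \<Longrightarrow> \<phi> i = i" and nd: "\<nexists>d. descending \<phi> d"
  shows "det (parent_matrix n \<phi>) = 0"
proof -
  define P where "P v m \<longleftrightarrow> \<phi> ((\<phi> ^^ m) v) = (\<phi> ^^ m) v" for v m
  have shift: "P (\<phi> v) m \<longleftrightarrow> P v (Suc m)" for v m
    by (simp only: P_def funpow_Suc_right o_apply)
  define L where "L v \<longleftrightarrow> (\<forall>m. \<not> P v m)" for v
  have "\<exists>v. L v"
  proof (rule ccontr)
    assume "\<not> ?thesis"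
    then have ex: "\<exists>m. P v m" for v by (auto simp: L_def)
    have "descending \<phi> (\<lambda>v. LEAST m. P v m)"
      unfolding descending_def
    proof (intro allI impI)
      fix v assume "\<phi> v \<noteq> v"
      then have "\<not> P v 0" by (simp add: P_def)
      obtain m where "P v m" using ex by blast
      have "(LEAST m. P v m) = Suc (LEAST m. P v (Suc m))"
        using Least_Suc[OF \<open>P v m\<close> \<open>\<not> P v 0\<close>] .
      then show "(LEAST m. P (\<phi> v) m) < (LEAST m. P v m)" by (simp add: shift)
    qed
    with nd show False by blast
  qed
  then obtain v where v: "L v" by blast
  have L_step: "L (\<phi> i) = L i" if "\<phi> i \<noteq> i" for i
    using that unfolding L_def shift by (metis P_def funpow_0 not0_implies_Suc)
  have L_fix: "\<not> L i" if "\<phi> i = i" for i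
    using that by (auto simp: L_def P_def intro: exI[of _ 0])
  have "v < n" using v L_fix \<phi>(2) by (meson not_le)
  let ?x = "vec n (\<lambda>i. of_bool (L i)) :: int vec"
  have "?x $ v \<noteq> 0\<^sub>v n $ v" using v \<open>v < n\<close> by simp
  then have "?x \<noteq> 0\<^sub>v n" by auto
  moreover have "parent_matrix n \<phi> *\<^sub>v ?x = 0\<^sub>v n"
  proof (rule eq_vecI)
    fix i assume "i < dim_vec (0\<^sub>v n :: int vec)"
    then have i: "i < n" by simp
    have "(parent_matrix n \<phi> *\<^sub>v ?x) $ i =
        (\<Sum>j = 0..<n. (of_bool (i = j) - of_bool (\<phi> i \<noteq> i \<and> \<phi> i = j)) * of_bool (L j))"
      using i by (simp add: parent_matrix_def scalar_prod_def)
    also have "\<dots> = (\<Sum>j = 0..<n. if i = j then of_bool (L j) else 0)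
        - (\<Sum>j = 0..<n. if \<phi> i = j then of_bool (\<phi> i \<noteq> i \<and> L j) else 0)"
      unfolding sum_subtractf[symmetric] by (intro sum.cong) auto
    also have "\<dots> = of_bool (L i) - of_bool (\<phi> i \<noteq> i \<and> L (\<phi> i))"
      using i \<phi>(1)[OF i] by simp
    also have "\<dots> = 0" using L_step[of i] L_fix[of i] by auto
    finally show "(parent_matrix n \<phi> *\<^sub>v ?x) $ i = 0\<^sub>v n $ i" using i by simp
  qed (simp add: parent_matrix_def)
  moreover have "parent_matrix n \<phi> \<in> carrier_mat n n" by (simp add: parent_matrix_def)
  ultimately show ?thesis
    by (subst det_0_iff_vec_prod_zero[of _ n]) (auto intro!: exI[of _ ?x])
qed

text \<open>
  The identity matrix plus the Laplacian.
\<close>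

definition shifted_laplacian :: "nat \<Rightarrow> nat set set \<Rightarrow> int mat" where
  "shifted_laplacian n E = mat n n (\<lambda>(i, j).
     of_bool (i = j) * (1 + (\<Sum>l<n. of_bool ({i, l} \<in> E))) - of_bool ({i, j} \<in> E))"

theorem matrix_forest_theorem:
  assumes G: "proper_graph ({..<n}, E)"
  shows "int (num_rooted_spanning_forests ({..<n}, E)) = det (shifted_laplacian n E)"
proof -
  have loop: "{i} \<notin> E" for i
    using proper_graphD(3)[OF G, of i i] by auto
  \<comment> \<open>\<open>a i j\<close> is the part of row \<open>i\<close> for the choice of \<open>j\<close> as parent of \<open>i\<close>; \<open>j = i\<close> makes \<open>i\<close> a root
    and accounts for the identity matrix.\<close>
  define a :: "nat \<Rightarrow> nat \<Rightarrow> int vec" where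
    "a i j = (if j = i \<or> {i, j} \<in> E then vec n (\<lambda>l. of_bool (i = l) - of_bool (j \<noteq> i \<and> j = l)) else 0\<^sub>v n)" for i j
  have ac: "a i j \<in> carrier_vec n" for i j by (simp add: a_def)
  define S where "S = {\<phi>. (\<forall>i \<in> {0..<n}. \<phi> i \<in> {0..<n}) \<and> (\<forall>i. i \<notin> {0..<n} \<longrightarrow> \<phi> i = i)}"
  have finS: "finite S"
    unfolding S_def by (rule finite_bounded_functions) auto
  have "shifted_laplacian n E = mat\<^sub>r n n (\<lambda>i. finsum_vec TYPE(int) n (a i) {0..<n})"
  proof (rule eq_matI)
    fix i l assume "i < dim_row (mat\<^sub>r n n (\<lambda>i. finsum_vec TYPE(int) n (a i) {0..<n}))"
      and "l < dim_col (mat\<^sub>r n n (\<lambda>i. finsum_vec TYPE(int) n (a i) {0..<n}))"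
    then have il: "i < n" "l < n" by auto
    have "finsum_vec TYPE(int) n (a i) {0..<n} $ l = (\<Sum>j = 0..<n. a i j $ l)"
      by (rule index_finsum_vec) (use il ac in auto)
    also have "\<dots> = (\<Sum>j = 0..<n. (if i = j then of_bool (i = l) else 0) + of_bool (i = l) * of_bool ({i, j} \<in> E)
        - (if l = j then of_bool ({i, j} \<in> E) else 0))"
      by (intro sum.cong) (use il loop in \<open>auto simp: a_def\<close>)
    also have "\<dots> = of_bool (i = l) * (1 + (\<Sum>j = 0..<n. of_bool ({i, j} \<in> E))) - of_bool ({i, l} \<in> E)"
      using il by (simp add: sum.distrib sum_subtractf sum_distrib_left distrib_left)
    finally show "shifted_laplacian n E $$ (i, l) =
        mat\<^sub>r n n (\<lambda>i. finsum_vec TYPE(int) n (a i) {0..<n}) $$ (i, l)"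
      using il by (simp add: shifted_laplacian_def atLeast0LessThan)
  qed (auto simp: shifted_laplacian_def)
  then have "det (shifted_laplacian n E) = (\<Sum>\<phi> \<in> S. det (mat\<^sub>r n n (\<lambda>i. a i (\<phi> i))))"
    unfolding S_def by (simp only:) (rule det_linear_rows_sum, use ac in auto)
  also have "\<dots> = (\<Sum>\<phi> \<in> S. of_bool (\<phi> \<in> parent_maps ({..<n}, E)))"
  proof (rule sum.cong)
    fix \<phi> assume S: "\<phi> \<in> S"
    show "det (mat\<^sub>r n n (\<lambda>i. a i (\<phi> i))) = of_bool (\<phi> \<in> parent_maps ({..<n}, E))"
    proof (cases "\<forall>i<n. \<phi> i = i \<or> {i, \<phi> i} \<in> E")
      case True
      then have eq: "mat\<^sub>r n n (\<lambda>i. a i (\<phi> i)) = parent_matrix n \<phi>"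
        by (intro eq_matI) (auto simp: a_def parent_matrix_def)
      have "parent_edges \<phi> \<subseteq> E"
        using True S by (auto simp: parent_edges_def S_def)
      then have "\<phi> \<in> parent_maps ({..<n}, E) \<longleftrightarrow> (\<exists>d. descending \<phi> d)"
        using S by (auto simp: parent_maps_def S_def)
      then show ?thesis
        unfolding eq using det_parent_matrix_descending det_parent_matrix_not_descending[of n \<phi>] S
        by (auto simp: S_def)
    next
      case False
      then obtain i where i: "i < n" "\<phi> i \<noteq> i" "{i, \<phi> i} \<notin> E" by blast
      then have "\<phi> \<notin> parent_maps ({..<n}, E)"
        by (auto simp: parent_maps_def parent_edges_def)
      moreover have "det (mat\<^sub>r n n (\<lambda>i. a i (\<phi> i))) = 0"
      proof -
        have "det (mat\<^sub>r n n (\<lambda>i. a i (\<phi> i))) =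
          (\<Sum>\<pi> | \<pi> permutes {0..<n}. signof \<pi> * (\<Prod>i = 0..<n. mat\<^sub>r n n (\<lambda>i. a i (\<phi> i)) $$ (i, \<pi> i)))"
          by (rule det_def') (simp add: carrier_matI)
        also have "\<dots> = 0"
        proof (rule sum.neutral, intro ballI)
          fix \<pi> assume "\<pi> \<in> {\<pi>. \<pi> permutes {0..<n}}"
          then have "\<pi> i < n" using i permutes_in_image[of \<pi> "{0..<n}" i] by simp
          then have "mat\<^sub>r n n (\<lambda>i. a i (\<phi> i)) $$ (i, \<pi> i) = 0"
            using i by (simp add: a_def)
          then show "signof \<pi> * (\<Prod>i = 0..<n. mat\<^sub>r n n (\<lambda>i. a i (\<phi> i)) $$ (i, \<pi> i)) = 0"
            using i by (auto intro!: prod_zero)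
        qed
        finally show ?thesis .
      qed
      ultimately show ?thesis by simp
    qed
  qed simp
  also have "\<dots> = int (card (S \<inter> parent_maps ({..<n}, E)))"
    using finS by (simp add: sum.If_cases of_bool_def)
  also have "S \<inter> parent_maps ({..<n}, E) = parent_maps ({..<n}, E)"
  proof -
    have "\<phi> i < n" if "\<phi> \<in> parent_maps ({..<n}, E)" "i < n" for \<phi> i
      using that proper_graphD(2)[OF G, of i "\<phi> i"]
      by (cases "\<phi> i = i") (auto simp: parent_maps_def parent_edges_def)
    moreover have "\<phi> i = i" if "\<phi> \<in> parent_maps ({..<n}, E)" "\<not> i < n" for \<phi> i
      using that by (auto simp: parent_maps_def)
    ultimately have "parent_maps ({..<n}, E) \<subseteq> S"
      unfolding S_def by auto
    then show ?thesis by blast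
  qed
  finally show ?thesis
    using num_rooted_spanning_forests_eq_card_parent_maps[OF G] by simp
qed

section \<open>Periodic functions on the integers\<close>

text \<open>
  The Kronecker delta of the residue classes modulo \<open>N\<close>. Working with periodic functions on the
  integers in place of residues keeps translation and reflection free of case distinctions.
\<close>

definition delta :: "nat \<Rightarrow> int \<Rightarrow> int" where
  "delta N x = of_bool (int N dvd x)"

lemma delta_uminus: "delta N (- x) = delta N x"
  by (simp add: delta_def)

lemma delta_minus_commute: "delta N (x - y) = delta N (y - x)"
  using delta_uminus[of N "x - y"] by simp

lemma delta_period: "delta N (x + int N) = delta N x"
  by (simp add: delta_def)

lemma delta_eq_of_bool:
  assumes "- int N < x" "x < int N"
  shows "delta N x = of_bool (x = 0)"
  using assms zdvd_imp_le[of "int N" x] zdvd_imp_le[of "int N" "- x"]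
  by (cases "x = 0"; cases "x > 0") (auto simp: delta_def)

lemma periodic_mod:
  assumes g: "\<And>x. g (x + int N) = g x"
  shows "g (x mod int N) = g x"
proof -
  have "g (x + int N * m) = g x" for x m
  proof (induction m arbitrary: x rule: int_induct[of _ 0])
    case (step1 i)
    then show ?case using g[of "x + int N * i"] by (simp add: algebra_simps)
  next
    case (step2 i)
    then show ?case using g[of "x + int N * (i - 1)"] by (simp add: algebra_simps)
  qed simp
  from this[of "x mod int N" "x div int N"] show ?thesis by simp
qed

text \<open>
  Only one \<open>j\<close> in the range is congruent to \<open>x\<close>.
\<close>

lemma sum_delta:
  assumes "N > 0" and g: "\<And>x. g (x + int N) = (g x :: int)"
  shows "(\<Sum>j<N. g (int j) * delta N (int j - x)) = g x"
proof -
  define y where "y = nat (x mod int N)"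
  have y: "y < N" "int y = x mod int N"
    using assms(1) by (auto simp: y_def nat_less_iff)
  have "delta N (int j - x) = of_bool (y = j)" if "j < N" for j
  proof -
    have "int N dvd int j - x \<longleftrightarrow> int j mod int N = x mod int N" by (simp add: mod_eq_dvd_iff)
    then show ?thesis using that y by (auto simp: delta_def)
  qed
  then have "(\<Sum>j<N. g (int j) * delta N (int j - x)) = (\<Sum>j<N. if y = j then g (int j) else 0)"
    by (intro sum.cong) auto
  also have "\<dots> = g (int y)" using y by simp
  also have "\<dots> = g x" using periodic_mod[of g N x] g y by simp
  finally show ?thesis .
qed

lemma sum_periodic_shift:
  assumes "N > 0" and g: "\<And>x. g (x + int N) = (g x :: int)"
  shows "(\<Sum>j<N. g (int j - x)) = (\<Sum>j<N. g (int j))"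
proof -
  have eq: "delta N (l - (j - x)) = delta N (j - (l + x))" for j l
    using delta_uminus[of N "j - (l + x)"] by (simp add: algebra_simps)
  have "(\<Sum>j<N. g (int j - x)) = (\<Sum>j<N. \<Sum>l<N. g (int l) * delta N (int l - (int j - x)))"
    using sum_delta[of N g] assms by simp
  also have "\<dots> = (\<Sum>j<N. \<Sum>l<N. g (int l) * delta N (int j - (int l + x)))"
    by (simp only: eq)
  also have "\<dots> = (\<Sum>l<N. g (int l) * (\<Sum>j<N. 1 * delta N (int j - (int l + x))))"
    by (subst sum.swap) (simp add: sum_distrib_left)
  also have "\<dots> = (\<Sum>l<N. g (int l))"
    using sum_delta[of N "\<lambda>_. 1"] assms by simp
  finally show ?thesis .
qed

definition parity_sign :: "int \<Rightarrow> int" where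
  "parity_sign x = (if even x then 1 else - 1)"

lemma parity_sign_add: "parity_sign (x + y) = parity_sign x * parity_sign y"
  by (simp add: parity_sign_def)

text \<open>
  The reflection of the residues modulo \<open>2 * n\<close> pairs \<open>j\<close> with \<open>2 * n - j\<close>, fixing 0 and \<open>n\<close>.
\<close>

lemma sum_reflect:
  fixes t :: "int \<Rightarrow> int"
  assumes "n > 0" and per: "\<And>x. t (x + 2 * int n) = t x" and ev: "\<And>x. t (- x) = t x"
    and "t 0 = 0" "t (int n) = 0"
  shows "(\<Sum>j<2 * n. t (int j)) = 2 * (\<Sum>j = 1..<n. t (int j))"
proof -
  have "(\<Sum>j \<in> {1..<n} \<union> {n + 1..<2 * n}. t (int j)) = (\<Sum>j<2 * n. t (int j))"
  proof (rule sum.mono_neutral_left)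
    show "\<forall>j \<in> {..<2 * n} - ({1..<n} \<union> {n + 1..<2 * n}). t (int j) = 0"
    proof
      fix j assume "j \<in> {..<2 * n} - ({1..<n} \<union> {n + 1..<2 * n})"
      then have "j = 0 \<or> j = n" by auto
      then show "t (int j) = 0" using assms(4,5) by auto
    qed
  qed (use assms(1) in auto)
  then have "(\<Sum>j<2 * n. t (int j)) = (\<Sum>j \<in> {1..<n} \<union> {n + 1..<2 * n}. t (int j))"
    by simp
  also have "\<dots> = (\<Sum>j = 1..<n. t (int j)) + (\<Sum>j = n + 1..<2 * n. t (int j))"
    by (rule sum.union_disjoint) auto
  also have "(\<Sum>j = n + 1..<2 * n. t (int j)) = (\<Sum>j = 1..<n. t (int j))"
  proof (rule sum.reindex_bij_witness[of _ "\<lambda>j. 2 * n - j" "\<lambda>j. 2 * n - j"])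
    fix j assume j: "j \<in> {n + 1..<2 * n}"
    have "t (int (2 * n - j)) = t (- int j + 2 * int n)"
      using j by (simp add: of_nat_diff)
    then show "t (int (2 * n - j)) = t (int j)" by (simp only: per ev)
  qed auto
  finally show ?thesis by simp
qed

text \<open>
  Oddness and periodicity force \<open>h\<close> to vanish at the two fixed points 0 and \<open>n\<close> of the reflection
  modulo \<open>2 * n\<close>, and the values at \<open>n + 1, \<dots>, 2 * n - 1\<close> are reflections of given ones.
\<close>

lemma odd_periodic_zero:
  fixes h :: "int \<Rightarrow> int"
  assumes "n > 0" and per: "\<And>x. h (x + 2 * int n) = h x" and odd: "\<And>x. h (- x) = - h x"
    and z: "\<And>i. 1 \<le> i \<Longrightarrow> i < n \<Longrightarrow> h (int i) = 0"
  shows "h x = 0"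
proof -
  have z': "h y = 0" if y: "0 \<le> y" "y \<le> int n" for y
  proof -
    consider "y = 0" | "1 \<le> nat y" "nat y < n" | "y = int n" using y by linarith
    then show ?thesis
    proof cases
      case 1 then show ?thesis using odd[of 0] by simp
    next
      case 2 then show ?thesis using z[of "nat y"] y by simp
    next
      case 3 then show ?thesis using odd[of "int n"] per[of "- int n"] by simp
    qed
  qed
  have z'': "h y = 0" if "0 \<le> y" "y < 2 * int n" for y
  proof (cases "y \<le> int n")
    case False
    have "h y = - h (- y + 2 * int n)" by (simp only: per odd minus_minus)
    then show ?thesis using z'[of "- y + 2 * int n"] False that by simp
  qed (use z' that in simp)
  have "h (x mod int (2 * n)) = h x"
    using per by (intro periodic_mod) simp
  then show ?thesis using z''[of "x mod int (2 * n)"] assms(1) by simp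
qed

lemma sum_lessThan_add:
  fixes f :: "nat \<Rightarrow> int"
  shows "(\<Sum>k = 0..<m + n. f k) = (\<Sum>k = 0..<m. f k) + (\<Sum>k = 0..<n. f (m + k))"
  by (induction n) (simp_all add: add.assoc)

section \<open>Determinants of symmetric circulant matrices\<close>

locale even_circulant =
  fixes n :: nat and c :: "int \<Rightarrow> int"
  assumes n_pos: "n > 0"
    and c_period: "c (x + 2 * int n) = c x"
    and c_even: "c (- x) = c x"
begin

definition circulant :: "int mat" where
  "circulant = mat (2 * n) (2 * n) (\<lambda>(i, j). c (int i - int j))"

text \<open>
  The action of the circulant on odd functions, in terms of their values at \<open>1, \<dots>, n - 1\<close>. The summand
  2 is due to the indices starting from 0.
\<close>

definition odd_block :: "int mat" where
  "odd_block = mat (n - 1) (n - 1) (\<lambda>(i, j). c (int i - int j) - c (int i + int j + 2))"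

text \<open>
  The functional \<open>g \<mapsto> g(i) - g(-i)\<close> as a row vector with entries indexed by \<open>x\<close>.
\<close>

definition odd_delta :: "int \<Rightarrow> int \<Rightarrow> int" where
  "odd_delta i x = delta (2 * n) (i - x) - delta (2 * n) (i + x)"

text \<open>
  The rows are the functionals that split the circulant: the sum of \<open>g\<close> (row 0), its odd part at
  \<open>1, \<dots>, n - 1\<close>, its alternating sum (row \<open>n\<close>), and the odd part of \<open>g(i + 1) - g(i - 1)\<close> for
  \<open>i = 1, \<dots>, n - 1\<close>. The last group carries the even part of \<open>g\<close> over to odd functions, on which the
  circulant acts by the same matrix as on the odd part.
\<close>

definition symmetry_basis :: "int mat" where
  "symmetry_basis = mat (2 * n) (2 * n) (\<lambda>(i, j).
     if i = 0 then 1 else if i < n then odd_delta (int i) (int j)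
     else if i = n then parity_sign (int j)
     else odd_delta (int i - int n) (int j - 1) - odd_delta (int i - int n) (int j + 1))"

text \<open>
  One functional of eigenvalue \<open>e\<close> followed by a copy of the action on odd functions, matching the
  order of the rows of \<open>symmetry_basis\<close>.
\<close>

definition bordered_block :: "int \<Rightarrow> int mat" where
  "bordered_block e = mat n n (\<lambda>(i, j).
     if i = 0 then (if j = 0 then e else 0)
     else if j = 0 then 0 else c (int i - int j) - c (int i + int j))"

lemma dims [simp]:
  "dim_row symmetry_basis = 2 * n" "dim_col symmetry_basis = 2 * n" "dim_row circulant = 2 * n"
  "dim_col circulant = 2 * n" "dim_row (bordered_block e) = n" "dim_col (bordered_block e) = n"
  by (simp_all add: symmetry_basis_def circulant_def bordered_block_def)

lemma det_bordered_block: "det (bordered_block e) = e * det odd_block"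
proof -
  have "bordered_block e = four_block_mat (mat 1 1 (\<lambda>_. e)) (0\<^sub>m 1 (n - 1)) (0\<^sub>m (n - 1) 1) odd_block"
    using n_pos
    by (intro eq_matI) (auto simp: bordered_block_def odd_block_def of_nat_diff algebra_simps Suc_le_eq)
  also have "det \<dots> = det (mat 1 1 (\<lambda>_. e)) * det odd_block"
    by (rule det_four_block_mat_upper_right_zero) (auto simp: odd_block_def)
  also have "det (mat 1 1 (\<lambda>_. e)) = e" by (subst det_single) auto
  finally show ?thesis .
qed


text \<open>
  The odd block takes the odd part of the delta function at \<open>x\<close> to its image under the circulant.
  Extending the sum to a full period counts everything twice, because a product of two odd functions is even.
\<close>

lemma odd_block_intertwines:
  "(\<Sum>j = 1..<n. (c (i - int j) - c (i + int j)) * odd_delta (int j) x) = c (i - x) - c (i + x)"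
proof -
  define h where "h y = c (i - y) - c (i + y)" for y
  have h_per: "h (y + int (2 * n)) = h y" for y
    using c_period[of "i - y - 2 * int n"] c_period[of "i + y"]
    by (simp add: h_def algebra_simps)
  have h_odd: "h (- y) = - h y" for y by (simp add: h_def)
  have o_per: "odd_delta (y + int (2 * n)) x = odd_delta y x" for y
    using delta_period[of "2 * n" "y - x"] delta_period[of "2 * n" "y + x"]
    by (simp add: odd_delta_def algebra_simps)
  have o_odd: "odd_delta (- y) x = - odd_delta y x" for y
  proof -
    have "- y - x = - (y + x)" "- y + x = - (y - x)" by auto
    then show ?thesis unfolding odd_delta_def by (metis delta_uminus minus_diff_eq)
  qed
  have "2 * (\<Sum>j = 1..<n. h (int j) * odd_delta (int j) x) = (\<Sum>j<2 * n. h (int j) * odd_delta (int j) x)"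
  proof (rule sum_reflect[symmetric, where t = "\<lambda>y. h y * odd_delta y x"])
    show "h (int n) * odd_delta (int n) x = 0"
      using h_per[of "- int n"] h_odd[of "int n"] by simp
  qed (use n_pos h_per o_per h_odd o_odd in \<open>auto simp: h_def[of 0]\<close>)
  also have "\<dots> = (\<Sum>j<2 * n. h (int j) * delta (2 * n) (int j - x))
      - (\<Sum>j<2 * n. h (int j) * delta (2 * n) (int j - (- x)))"
    by (simp add: odd_delta_def sum_subtractf right_diff_distrib)
  also have "\<dots> = h x - h (- x)"
    using n_pos h_per sum_delta[of "2 * n" h x] sum_delta[of "2 * n" h "- x"] by simp
  also have "\<dots> = 2 * h x" using h_odd by simp
  finally show ?thesis by (simp add: h_def)
qed

lemma sum_odd_delta:
  assumes g: "\<And>x. g (x + 2 * int n) = (g x :: int)"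
  shows "(\<Sum>j<2 * n. odd_delta i (int j - s) * g (int j)) = g (i + s) - g (s - i)"
proof -
  have eq: "odd_delta i (y - s) = delta (2 * n) (y - (i + s)) - delta (2 * n) (y - (s - i))" for y
    using delta_minus_commute[of "2 * n" y "i + s"] by (simp add: odd_delta_def algebra_simps)
  have "(\<Sum>j<2 * n. odd_delta i (int j - s) * g (int j)) =
      (\<Sum>j<2 * n. g (int j) * delta (2 * n) (int j - (i + s)))
      - (\<Sum>j<2 * n. g (int j) * delta (2 * n) (int j - (s - i)))"
    unfolding sum_subtractf[symmetric] by (intro sum.cong) (simp_all only: eq left_diff_distrib mult.commute[of "g _"])
  also have "\<dots> = g (i + s) - g (s - i)"
    using n_pos g sum_delta[of "2 * n" g] by simp
  finally show ?thesis .
qed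

lemma symmetry_basis_mult_vec:
  fixes g :: "int \<Rightarrow> int"
  assumes g: "\<And>x. g (x + 2 * int n) = g x" and i: "i < 2 * n"
  shows "(\<Sum>j<2 * n. symmetry_basis $$ (i, j) * g (int j)) =
    (if i = 0 then (\<Sum>j<2 * n. g (int j))
     else if i < n then g (int i) - g (- int i)
     else if i = n then (\<Sum>j<2 * n. parity_sign (int j) * g (int j))
     else (g (int i - int n + 1) - g (1 - (int i - int n)))
        - (g (int i - int n - 1) - g (- 1 - (int i - int n))))"
proof -
  have "(\<Sum>j<2 * n. (odd_delta (int i - int n) (int j - 1) - odd_delta (int i - int n) (int j + 1)) * g (int j)) =
      (\<Sum>j<2 * n. odd_delta (int i - int n) (int j - 1) * g (int j))
      - (\<Sum>j<2 * n. odd_delta (int i - int n) (int j - (- 1)) * g (int j))"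
    by (simp add: left_diff_distrib sum_subtractf)
  then show ?thesis
    using i sum_odd_delta[of g "int i" 0, OF g]
      sum_odd_delta[of g "int i - int n" 1, OF g] sum_odd_delta[of g "int i - int n" "- 1", OF g]
    by (auto simp: symmetry_basis_def)
qed

text \<open>
  A periodic function \<open>g\<close> annihilated by all rows has no odd part, hence is even; then
  \<open>g(i + 1) - g(i - 1)\<close> is odd and so vanishes too, which leaves a function of the parity of its
  argument. Such a function vanishes if its sum and its alternating sum do.
\<close>

lemma det_symmetry_basis_nonzero: "det symmetry_basis \<noteq> 0"
proof
  have B: "symmetry_basis \<in> carrier_mat (2 * n) (2 * n)" by (simp add: symmetry_basis_def)
  assume "det symmetry_basis = 0"
  then obtain v where v: "v \<in> carrier_vec (2 * n)" "v \<noteq> 0\<^sub>v (2 * n)" "symmetry_basis *\<^sub>v v = 0\<^sub>v (2 * n)"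
    using det_0_iff_vec_prod_zero[OF B] by blast
  define g where "g x = v $ nat (x mod (2 * int n))" for x
  have g_per: "g (x + 2 * int n) = g x" for x by (simp add: g_def)
  have g_nat: "g (int j) = v $ j" if "j < 2 * n" for j
    using that by (simp add: g_def)
  have row0: "(\<Sum>j<2 * n. symmetry_basis $$ (i, j) * g (int j)) = 0" if i: "i < 2 * n" for i
  proof -
    have "(symmetry_basis *\<^sub>v v) $ i = (\<Sum>j = 0..<2 * n. symmetry_basis $$ (i, j) * v $ j)"
      using i B v(1) by (simp add: scalar_prod_def)
    then show ?thesis using v(3) i g_nat by (simp add: atLeast0LessThan)
  qed
  have even_g: "g x = g (- x)" for x
  proof -
    have "g x - g (- x) = 0"
    proof (rule odd_periodic_zero[of n "\<lambda>x. g x - g (- x)", OF n_pos])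
      show "g (y + 2 * int n) - g (- (y + 2 * int n)) = g y - g (- y)" for y
        using g_per[of y] g_per[of "- y - 2 * int n"] by simp
      show "g (int i) - g (- int i) = 0" if "1 \<le> i" "i < n" for i
        using that row0[of i] symmetry_basis_mult_vec[of g i, OF g_per] by simp
    qed simp
    then show ?thesis by simp
  qed
  have step: "g (x + 1) = g (x - 1)" for x
  proof -
    have "g (x + 1) - g (x - 1) = 0"
    proof (rule odd_periodic_zero[of n "\<lambda>x. g (x + 1) - g (x - 1)", OF n_pos])
      show "g (y + 2 * int n + 1) - g (y + 2 * int n - 1) = g (y + 1) - g (y - 1)" for y
        using g_per[of "y + 1"] g_per[of "y - 1"] by (simp add: algebra_simps)
      show "g (- y + 1) - g (- y - 1) = - (g (y + 1) - g (y - 1))" for y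
      proof -
        have "- y + 1 = - (y - 1)" "- y - 1 = - (y + 1)" by simp_all
        then show ?thesis using even_g[of "y + 1"] even_g[of "y - 1"] by (simp only:)
      qed
      show "g (int i + 1) - g (int i - 1) = 0" if "1 \<le> i" "i < n" for i
        using that row0[of "n + i"] symmetry_basis_mult_vec[of g "n + i", OF g_per]
          even_g[of "int i + 1"] even_g[of "int i - 1"] by (simp add: algebra_simps)
    qed
    then show ?thesis by simp
  qed
  have g_even: "g (int (2 * m)) = g 0" and g_odd: "g (int (2 * m + 1)) = g 1" for m
  proof -
    show "g (int (2 * m)) = g 0"
    proof (induction m)
      case (Suc m) then show ?case using step[of "int (2 * m + 1)"] by (simp add: algebra_simps)
    qed simp
    show "g (int (2 * m + 1)) = g 1"
    proof (induction m)
      case (Suc m) then show ?case using step[of "int (2 * m + 2)"] by (simp add: algebra_simps)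
    qed simp
  qed
  have "(\<Sum>j<2 * m. g (int j)) = int m * (g 0 + g 1)" for m
  proof (induction m)
    case (Suc m)
    then show ?case using g_even[of m] g_odd[of m] by (simp add: algebra_simps)
  qed simp
  then have plus: "g 0 + g 1 = 0"
    using row0[of 0] symmetry_basis_mult_vec[of g 0, OF g_per] n_pos by simp
  have "(\<Sum>j<2 * m. parity_sign (int j) * g (int j)) = int m * (g 0 - g 1)" for m
  proof (induction m)
    case (Suc m)
    then show ?case using g_even[of m] g_odd[of m] by (simp add: algebra_simps parity_sign_def)
  qed simp
  then have minus: "g 0 - g 1 = 0"
    using row0[of n] symmetry_basis_mult_vec[of g n, OF g_per] n_pos by simp
  have g0: "g 0 = 0" "g 1 = 0" using plus minus by simp_all
  have "v $ j = 0" if "j < 2 * n" for j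
    using that g_nat[of j] g_even[of "j div 2"] g_odd[of "j div 2"] g0
    by (cases "even j") (auto elim!: evenE oddE)
  then have "v = 0\<^sub>v (2 * n)" using v(1) by (intro eq_vecI) auto
  with v(2) show False by simp
qed

text \<open>
  The circulant and a block diagonal matrix are conjugate over the rationals by \<open>symmetry_basis\<close>;
  cancelling its nonzero determinant keeps the argument in the integers.
\<close>

theorem det_circulant:
  "det circulant = (\<Sum>j<2 * n. c (int j)) * (\<Sum>j<2 * n. parity_sign (int j) * c (int j)) * (det odd_block)\<^sup>2"
    (is "_ = ?e1 * ?e2 * _")
proof -
  let ?B = "four_block_mat (bordered_block ?e1) (0\<^sub>m n n) (0\<^sub>m n n) (bordered_block ?e2)"
  have H: "bordered_block e \<in> carrier_mat n n" for e by (simp add: bordered_block_def)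
  have B: "?B \<in> carrier_mat (2 * n) (2 * n)" using H by (simp add: mult_2)
  have E: "symmetry_basis \<in> carrier_mat (2 * n) (2 * n)" and C: "circulant \<in> carrier_mat (2 * n) (2 * n)"
    by (simp_all add: symmetry_basis_def circulant_def)
  have "symmetry_basis * circulant = ?B * symmetry_basis"
  proof (rule eq_matI)
    fix i l assume "i < dim_row (?B * symmetry_basis)" "l < dim_col (?B * symmetry_basis)"
    then have il: "i < 2 * n" "l < 2 * n" by simp_all
    define g where "g x = c (x - int l)" for x
    have g_per: "g (x + 2 * int n) = g x" for x
      using c_period[of "x - int l"] by (simp add: g_def algebra_simps)
    have sum_half: "(\<Sum>k = 0..<n. bordered_block e $$ (r, k) * f k) =
        (if r = 0 then e * f 0 else (\<Sum>k = 1..<n. (c (int r - int k) - c (int r + int k)) * f k))"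
      if "r < n" for e r f
      using that n_pos by (auto simp: sum.atLeast_Suc_lessThan bordered_block_def intro!: sum.neutral)
    have s1: "(\<Sum>j<2 * n. g (int j)) = ?e1"
      unfolding g_def by (rule sum_periodic_shift) (use n_pos c_period in auto)
    have s2: "(\<Sum>j<2 * n. parity_sign (int j) * g (int j)) = parity_sign (int l) * ?e2"
    proof -
      have "parity_sign (int j) * g (int j) =
          parity_sign (int l) * (parity_sign (int j - int l) * c (int j - int l))" for j
        using parity_sign_add[of "int l" "int j - int l"] by (simp add: g_def)
      then show ?thesis
        using sum_periodic_shift[of "2 * n" "\<lambda>x. parity_sign x * c x" "int l"] n_pos c_period
        by (simp add: sum_distrib_left[symmetric] parity_sign_def)
    qed
    have "(symmetry_basis * circulant) $$ (i, l) = (\<Sum>j<2 * n. symmetry_basis $$ (i, j) * g (int j))"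
      using il by (simp add: scalar_prod_def circulant_def g_def atLeast0LessThan)
    also have "\<dots> = (if i = 0 then ?e1
     else if i < n then c (int i - int l) - c (int i + int l)
     else if i = n then parity_sign (int l) * ?e2
     else (c (int i - int n - (int l - 1)) - c (int i - int n + (int l - 1)))
        - (c (int i - int n - (int l + 1)) - c (int i - int n + (int l + 1))))"
      unfolding symmetry_basis_mult_vec[of g i, OF g_per il(1)] s1 s2
      using c_even[of "int i + int l"] c_even[of "int i - int n + (int l - 1)"]
        c_even[of "int i - int n + (int l + 1)"]
      by (simp add: g_def algebra_simps)
    also have "\<dots> = (\<Sum>k = 0..<n + n. ?B $$ (i, k) * symmetry_basis $$ (k, l))"
    proof -
      have "(\<Sum>k = 0..<n + n. ?B $$ (i, k) * symmetry_basis $$ (k, l)) =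
        (\<Sum>k = 0..<n. ?B $$ (i, k) * symmetry_basis $$ (k, l)) + (\<Sum>k = 0..<n. ?B $$ (i, n + k) * symmetry_basis $$ (n + k, l))"
        by (rule sum_lessThan_add)
      also have "\<dots> = (if i < n then (\<Sum>k = 0..<n. bordered_block ?e1 $$ (i, k) * symmetry_basis $$ (k, l))
          else (\<Sum>k = 0..<n. bordered_block ?e2 $$ (i - n, k) * symmetry_basis $$ (n + k, l)))"
        using il by auto
      also have "\<dots> = (if i = 0 then ?e1
     else if i < n then c (int i - int l) - c (int i + int l)
     else if i = n then parity_sign (int l) * ?e2
     else (c (int i - int n - (int l - 1)) - c (int i - int n + (int l - 1)))
        - (c (int i - int n - (int l + 1)) - c (int i - int n + (int l + 1))))"
      proof -
        consider "i = 0" | "0 < i" "i < n" | "i = n" | "n < i" by linarith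
        then show ?thesis
        proof cases
          case 1
          then show ?thesis using n_pos il by (simp add: sum_half symmetry_basis_def)
        next
          case 2
          have "(\<Sum>k = 1..<n. (c (int i - int k) - c (int i + int k)) * symmetry_basis $$ (k, l)) =
            (\<Sum>k = 1..<n. (c (int i - int k) - c (int i + int k)) * odd_delta (int k) (int l))"
            using il by (intro sum.cong) (auto simp: symmetry_basis_def)
          then show ?thesis using 2 by (simp add: sum_half odd_block_intertwines del: One_nat_def)
        next
          case 3
          then show ?thesis using n_pos il by (simp add: sum_half symmetry_basis_def)
        next
          case 4
          let ?i = "int i - int n"
          have "(\<Sum>k = 1..<n. (c (?i - int k) - c (?i + int k)) * symmetry_basis $$ (n + k, l)) =
            (\<Sum>k = 1..<n. (c (?i - int k) - c (?i + int k)) * odd_delta (int k) (int l - 1))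
            - (\<Sum>k = 1..<n. (c (?i - int k) - c (?i + int k)) * odd_delta (int k) (int l + 1))"
            unfolding sum_subtractf[symmetric]
            using il by (intro sum.cong) (auto simp: symmetry_basis_def right_diff_distrib)
          then show ?thesis using 4 il n_pos
            by (simp add: sum_half odd_block_intertwines of_nat_diff del: One_nat_def)
        qed
      qed
      finally show ?thesis by simp
    qed
    also have "\<dots> = (?B * symmetry_basis) $$ (i, l)"
      using il by (simp add: scalar_prod_def mult_2)
    finally show "(symmetry_basis * circulant) $$ (i, l) = (?B * symmetry_basis) $$ (i, l)" .
  qed (use E C B in simp_all)
  then have "det symmetry_basis * det circulant = det ?B * det symmetry_basis"
    using det_mult[OF E C] det_mult[OF B E] by (simp only:)
  then have "det circulant = det ?B"
    using det_symmetry_basis_nonzero by simp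
  also have "\<dots> = det (bordered_block ?e1) * det (bordered_block ?e2)"
    by (rule det_four_block_mat_upper_right_zero) (use H in auto)
  finally show ?thesis by (simp add: det_bordered_block power2_eq_square)
qed

end

section \<open>Circulant graphs with an even number of vertices\<close>

lemma sum_delta_finite_set:
  assumes "finite D" "D \<subseteq> {..<N}" "N > 0"
  shows "(\<Sum>r \<in> D. delta N (x - int r)) = of_bool (nat (x mod int N) \<in> D)"
proof -
  have "delta N (x - int r) = (if nat (x mod int N) = r then 1 else 0)" if "r \<in> D" for r
  proof -
    have "r < N" using that assms(2) by auto
    have "int N dvd x - int r \<longleftrightarrow> x mod int N = int r"
      using \<open>r < N\<close> by (simp add: mod_eq_dvd_iff[symmetric])
    moreover have "0 \<le> x mod int N" using assms(3) by simp
    ultimately show ?thesis by (simp add: delta_def nat_eq_iff)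
  qed
  then show ?thesis using assms(1) by simp
qed

text \<open>
  Here \<open>D\<close> is the set of residues \<open>i - j\<close> over all edges, and \<open>c\<close> is the first column of the matrix.
  Pairing \<open>c\<close> with a periodic \<open>g\<close> gives \<open>g(0)\<close> plus the sum of \<open>g(0) - g(r)\<close> over \<open>D\<close>; for \<open>g = 1\<close>
  this is 1, and for the alternating sign every odd \<open>r\<close> contributes 2.
\<close>

lemma det_shifted_laplacian_circulant:
  assumes n: "n > 0" and D: "D \<subseteq> {1..<2 * n}" and sym: "\<And>r. r \<in> D \<Longrightarrow> 2 * n - r \<in> D"
    and E: "\<And>i j. i < 2 * n \<Longrightarrow> j < 2 * n \<Longrightarrow>
              {i, j} \<in> E \<longleftrightarrow> nat ((int i - int j) mod int (2 * n)) \<in> D"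
  shows "\<exists>b. det (shifted_laplacian (2 * n) E) = (1 + 2 * int (card {r \<in> D. odd r})) * b\<^sup>2"
proof -
  let ?N = "2 * n"
  have finD: "finite D" and DN: "D \<subseteq> {..<?N}" using D by (auto intro: finite_subset)
  define c where "c x = (1 + int (card D)) * delta ?N x - (\<Sum>r \<in> D. delta ?N (x - int r))" for x
  have c_per: "c (x + 2 * int n) = c x" for x
    using delta_period[of ?N x] delta_period[of ?N "x - int r" for r] by (simp add: c_def algebra_simps)
  have "(\<Sum>r \<in> D. delta ?N (- x - int r)) = (\<Sum>r \<in> D. delta ?N (x - int r))" for x
  proof (rule sum.reindex_bij_witness[of _ "\<lambda>r. ?N - r" "\<lambda>r. ?N - r"])
    fix r assume r: "r \<in> D"
    then have "r < ?N" using D by auto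
    then have "delta ?N (x - int (?N - r)) = delta ?N (x + int r - int ?N + int ?N)"
      unfolding delta_period by (simp add: of_nat_diff algebra_simps)
    also have "\<dots> = delta ?N (- x - int r)"
      using delta_uminus[of ?N "x + int r"] by (simp add: algebra_simps)
    finally show "delta ?N (x - int (?N - r)) = delta ?N (- x - int r)" .
    show "?N - (?N - r) = r" using \<open>r < ?N\<close> by simp
  qed (use D sym in \<open>force+\<close>)
  then have c_ev: "c (- x) = c x" for x by (simp add: c_def delta_uminus)
  interpret even_circulant n c
    by unfold_locales (use n c_per c_ev in auto)
  have adj: "of_bool ({i, j} \<in> E) = (\<Sum>r \<in> D. delta ?N (int i - int j - int r))"
    if "i < ?N" "j < ?N" for i j
    using sum_delta_finite_set[OF finD DN, of "int i - int j"] n E[OF that] by simp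
  have deg: "(\<Sum>l<?N. of_bool ({i, l} \<in> E)) = int (card D)" if "i < ?N" for i
  proof -
    have "(\<Sum>l<?N. of_bool ({i, l} \<in> E)) = (\<Sum>l<?N. \<Sum>r \<in> D. 1 * delta ?N (int l - (int i - int r)))"
      using that adj delta_minus_commute[of ?N "int l" "int i - int r" for l r]
      by (intro sum.cong) (auto simp: algebra_simps)
    also have "\<dots> = (\<Sum>r \<in> D. 1)"
      by (subst sum.swap, intro sum.cong refl sum_delta) (use n in auto)
    finally show ?thesis by simp
  qed
  have "shifted_laplacian ?N E = circulant"
  proof (rule eq_matI)
    fix i j assume "i < dim_row circulant" "j < dim_col circulant"
    then have ij: "i < ?N" "j < ?N" by (simp_all add: circulant_def)
    have delta_ij: "delta ?N (int i - int j) = of_bool (i = j)"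
      using ij by (subst delta_eq_of_bool) auto
    show "shifted_laplacian ?N E $$ (i, j) = circulant $$ (i, j)"
      unfolding shifted_laplacian_def circulant_def c_def
      by (simp only: index_mat(1)[OF ij] prod.case deg[OF ij(1)] adj[OF ij] delta_ij)
        (simp add: mult.commute)
  qed (auto simp: shifted_laplacian_def circulant_def)
  moreover have eval: "(\<Sum>j<?N. g (int j) * c (int j)) =
      (1 + int (card D)) * g 0 - (\<Sum>r \<in> D. g (int r))"
    if per: "\<And>x. g (x + int ?N) = g x" for g :: "int \<Rightarrow> int"
  proof -
    have "(\<Sum>j<?N. g (int j) * c (int j)) =
      (1 + int (card D)) * (\<Sum>j<?N. g (int j) * delta ?N (int j - 0))
      - (\<Sum>j<?N. \<Sum>r \<in> D. g (int j) * delta ?N (int j - int r))"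
      by (simp add: c_def algebra_simps sum_subtractf sum_distrib_left sum.distrib)
    also have "\<dots> = (1 + int (card D)) * g 0 - (\<Sum>r \<in> D. g (int r))"
      using sum_delta[of ?N g 0, OF _ per] sum_delta[of ?N g, OF _ per] n by (subst sum.swap) simp
    finally show ?thesis .
  qed
  have "(\<Sum>j<?N. c (int j)) = 1" using eval[of "\<lambda>_. 1"] by simp
  moreover have "(\<Sum>j<?N. parity_sign (int j) * c (int j)) = 1 + 2 * int (card {r \<in> D. odd r})"
  proof -
    have "(\<Sum>j<?N. parity_sign (int j) * c (int j)) = 1 + (\<Sum>r \<in> D. 1 - parity_sign (int r))"
      by (subst eval) (auto simp: parity_sign_def sum_subtractf)
    also have "(\<Sum>r \<in> D. 1 - parity_sign (int r)) = (\<Sum>r \<in> {r \<in> D. odd r}. 2)"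
      by (rule sum.mono_neutral_cong_right) (use finD in \<open>auto simp: parity_sign_def\<close>)
    finally show ?thesis by simp
  qed
  ultimately show ?thesis using det_circulant by auto
qed

lemma circulant_graph_edge_iff:
  assumes "i < m" "j < m"
  shows "{i, j} \<in> edges (circulant_graph m T) \<longleftrightarrow>
    (\<exists>t \<in> T. int m dvd int i - int j - int t \<or> int m dvd int i - int j + int t)"
proof -
  have mod: "b = (a + t) mod m \<longleftrightarrow> int m dvd int a - int b + int t" if "b < m" for a b t :: nat
  proof -
    have "b = (a + t) mod m \<longleftrightarrow> int ((a + t) mod m) = int (b mod m)" using that by auto
    also have "\<dots> \<longleftrightarrow> int m dvd int (a + t) - int b" by (simp only: zmod_int mod_eq_dvd_iff)
    finally show ?thesis by (simp add: algebra_simps)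
  qed
  have "{i, j} \<in> edges (circulant_graph m T) \<longleftrightarrow> (\<exists>t \<in> T. j = (i + t) mod m \<or> i = (j + t) mod m)"
    using assms by (auto simp: circulant_graph_def doubleton_eq_iff)
  also have "\<dots> \<longleftrightarrow> (\<exists>t \<in> T. int m dvd int i - int j + int t \<or> int m dvd int j - int i + int t)"
    using mod assms by simp
  also have "\<dots> \<longleftrightarrow> (\<exists>t \<in> T. int m dvd int i - int j - int t \<or> int m dvd int i - int j + int t)"
  proof -
    have "int m dvd int j - int i + int t \<longleftrightarrow> int m dvd int i - int j - int t" for t
      using dvd_minus_iff[of "int m" "int i - int j - int t"] by (simp add: algebra_simps)
    then show ?thesis by auto
  qed
  finally show ?thesis .
qed

lemma proper_circulant_graph:
  assumes "\<And>t. t \<in> T \<Longrightarrow> 0 < t \<and> t < m"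
  shows "proper_graph (circulant_graph m T)"
proof -
  have "(i + t) mod m \<noteq> i" if "i < m" "t \<in> T" for i t
    using assms[OF that(2)] that(1) by (auto simp: mod_if)
  then show ?thesis
    unfolding proper_graph_def circulant_graph_def by fastforce
qed

text \<open>
  Each \<open>t \<in> S\<close> gives two residues \<open>t\<close> and \<open>2 * n - t\<close> of the same parity, while \<open>n\<close> gives one.
\<close>

theorem num_rooted_spanning_forests_circulant:
  assumes fin: "finite S" and S: "\<And>t. t \<in> S \<Longrightarrow> 1 \<le> t \<and> t < n" and n: "n > 0"
  shows "\<exists>b. int (num_rooted_spanning_forests (circulant_graph (2 * n) (S \<union> {n}))) =
    (if even n then 4 * int (card {t \<in> S. odd t}) + 1 else 4 * int (card {t \<in> S. odd t}) + 3) * b\<^sup>2"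
proof -
  let ?N = "2 * n" and ?r = "\<lambda>t. 2 * n - t"
  let ?G = "circulant_graph ?N (S \<union> {n})"
  define D where "D = S \<union> ?r ` S \<union> {n}"
  have D: "D \<subseteq> {1..<?N}" using S n by (fastforce simp: D_def)
  have sym: "?r r \<in> D" if "r \<in> D" for r
    using that S by (force simp: D_def)
  have edge: "{i, j} \<in> edges ?G \<longleftrightarrow> nat ((int i - int j) mod int ?N) \<in> D" if "i < ?N" "j < ?N" for i j
  proof -
    let ?x = "int i - int j"
    have in_set: "nat (?x mod int ?N) \<in> A \<longleftrightarrow> (\<exists>r \<in> A. int ?N dvd ?x - int r)" if "A \<subseteq> {..<?N}" for A
    proof -
      have "int ?N dvd ?x - int r \<longleftrightarrow> nat (?x mod int ?N) = r" if "r < ?N" for r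
      proof -
        have "int ?N dvd ?x - int r \<longleftrightarrow> ?x mod int ?N = int r mod int ?N"
          by (simp only: mod_eq_dvd_iff)
        also have "\<dots> \<longleftrightarrow> nat (?x mod int ?N) = r"
          using that n by (auto simp: nat_eq_iff)
        finally show ?thesis .
      qed
      then show ?thesis using that by blast
    qed
    have shift: "int ?N dvd ?x - int (?r t) \<longleftrightarrow> int ?N dvd ?x + int t" if "t \<le> ?N" for t
    proof -
      have "?x + int t = ?x - int (?r t) + int ?N" using that by (simp add: of_nat_diff)
      then show ?thesis by (metis dvd_add_triv_right_iff)
    qed
    have refl: "int ?N dvd ?x - int (?r t) \<longleftrightarrow> int ?N dvd ?x + int t" if "t \<in> S \<union> {n}" for t
    proof -
      have "t \<le> ?N" using that S[of t] by auto
      then show ?thesis by (rule shift)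
    qed
    have D_eq: "D = (S \<union> {n}) \<union> ?r ` (S \<union> {n})" by (auto simp: D_def)
    have "nat (?x mod int ?N) \<in> D \<longleftrightarrow> (\<exists>r \<in> D. int ?N dvd ?x - int r)"
      by (rule in_set) (use D in auto)
    also have "\<dots> \<longleftrightarrow> (\<exists>t \<in> S \<union> {n}. int ?N dvd ?x - int t \<or> int ?N dvd ?x - int (?r t))"
      unfolding D_eq by blast
    also have "\<dots> \<longleftrightarrow> {i, j} \<in> edges ?G"
      unfolding circulant_graph_edge_iff[OF that] by (rule bex_cong) (simp_all only: refl)
    finally show ?thesis ..
  qed
  have odd_card: "int (card {r \<in> D. odd r}) = 2 * int (card {t \<in> S. odd t}) + (if odd n then 1 else 0)"
  proof -
    let ?S = "{t \<in> S. odd t}"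
    have eq: "{r \<in> D. odd r} = (?S \<union> ?r ` ?S) \<union> (if odd n then {n} else {})"
    proof -
      have "odd (?r t) \<longleftrightarrow> odd t" if "t \<in> S" for t using S[OF that] by (simp add: even_diff_nat)
      moreover have "\<not> 2 * n < t" if "t \<in> S" for t using S[OF that] by simp
      ultimately show ?thesis by (auto simp: D_def)
    qed
    have disj: "t \<noteq> ?r u" if "t \<in> S" "u \<in> S" for t u
      using S[OF that(1)] S[OF that(2)] by linarith
    have inj: "t = u" if "t \<in> S" "u \<in> S" "?r t = ?r u" for t u
      using S[OF that(1)] S[OF that(2)] that(3) by linarith
    have "card (?S \<union> ?r ` ?S) = card ?S + card (?r ` ?S)"
      using fin disj by (intro card_Un_disjoint) auto
    also have "card (?r ` ?S) = card ?S"
      using inj by (intro card_image inj_onI) auto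
    finally have c2: "card (?S \<union> ?r ` ?S) = 2 * card ?S" by simp
    have "n \<noteq> t \<and> n \<noteq> ?r t" if "t \<in> S" for t
      using S[OF that] by linarith
    then have "n \<notin> ?S \<union> ?r ` ?S" by blast
    then have "card (insert n (?S \<union> ?r ` ?S)) = Suc (2 * card ?S)"
      using fin c2 by (subst card_insert_disjoint) simp_all
    then show ?thesis unfolding eq using c2 by simp
  qed
  have V: "verts ?G = {..<?N}" by (simp add: circulant_graph_def)
  have proper: "proper_graph ?G"
    by (rule proper_circulant_graph) (use S n in force)
  have "int (num_rooted_spanning_forests ?G) = det (shifted_laplacian ?N (edges ?G))"
    using matrix_forest_theorem[of ?N "edges ?G"] proper V by (metis prod.collapse)
  moreover obtain b where "det (shifted_laplacian ?N (edges ?G)) = (1 + 2 * int (card {r \<in> D. odd r})) * b\<^sup>2"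
    using det_shifted_laplacian_circulant[OF n D sym edge] by blast
  ultimately show ?thesis
    unfolding odd_card by (auto intro!: exI[of _ b])
qed

theorem theorem4:
  fixes k :: nat and s :: "nat \<Rightarrow> nat" and f :: "nat \<Rightarrow> nat" and p q r :: nat
  assumes "k \<ge> 1"
    and "1 \<le> s 1"
    and "strict_mono_on {1..k} s"
    and "\<And>n. n > s k \<Longrightarrow>
           f n = num_rooted_spanning_forests (circulant_graph (2 * n) (s ` {1..k} \<union> {n}))"
    and "p = card {j \<in> {1..k}. odd (s j)}"
    and "q = squarefree_part (4 * p + 1)"
    and "r = squarefree_part (4 * p + 3)"
  shows "\<exists>a :: nat \<Rightarrow> int. \<forall>n > s k.
           (even n \<longrightarrow> int (f n) = int q * (a n)\<^sup>2) \<and>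
           (odd n \<longrightarrow> int (f n) = int r * (a n)\<^sup>2)"
proof -
  let ?S = "s ` {1..k}"
  have "{t \<in> ?S. odd t} = s ` {j \<in> {1..k}. odd (s j)}" by auto
  moreover have "inj_on s {j \<in> {1..k}. odd (s j)}"
    by (rule inj_on_subset[OF strict_mono_on_imp_inj_on[OF assms(3)]]) auto
  ultimately have p: "card {t \<in> ?S. odd t} = p"
    using assms(5) card_image by fastforce
  have range: "1 \<le> t \<and> t \<le> s k" if t: "t \<in> ?S" for t
  proof -
    obtain j where j: "1 \<le> j" "j \<le> k" "t = s j" using t by auto
    have mono: "s i \<le> s l" if "1 \<le> i" "i \<le> l" "l \<le> k" for i l
      using strict_mono_onD[OF assms(3), of i l] that by (cases "i = l") auto
    show ?thesis using mono[of 1 j] mono[of j k] j assms(2) by simp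
  qed
  have "\<exists>a. (even n \<longrightarrow> int (f n) = int q * a\<^sup>2) \<and> (odd n \<longrightarrow> int (f n) = int r * a\<^sup>2)" if n: "n > s k" for n
  proof -
    define m where "m = (if even n then 4 * p + 1 else 4 * p + 3)"
    have "\<exists>b. int (f n) = (if even n then 4 * int (card {t \<in> ?S. odd t}) + 1
        else 4 * int (card {t \<in> ?S. odd t}) + 3) * b\<^sup>2"
      unfolding assms(4)[OF n]
    proof (rule num_rooted_spanning_forests_circulant)
      show "finite ?S" by simp
      show "0 < n" using n by linarith
      show "1 \<le> t \<and> t < n" if "t \<in> ?S" for t
        using range[OF that] n by linarith
    qed
    then obtain b where "int (f n) = (if even n then 4 * int p + 1 else 4 * int p + 3) * b\<^sup>2"
      unfolding p by blast
    then have b: "int (f n) = int m * b\<^sup>2" by (simp add: m_def)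
    have "int m = int (squarefree_part m * (square_part m)\<^sup>2)"
      by (simp only: squarefree_decompose[symmetric])
    then have "int (f n) = int (squarefree_part m) * (int (square_part m) * b)\<^sup>2"
      unfolding b by (simp only: of_nat_mult of_nat_power power_mult_distrib mult.assoc)
    then show ?thesis
      by (intro exI[of _ "int (square_part m) * b"]) (simp add: m_def assms(6,7))
  qed
  then have "\<forall>n. \<exists>a. s k < n \<longrightarrow>
      (even n \<longrightarrow> int (f n) = int q * a\<^sup>2) \<and> (odd n \<longrightarrow> int (f n) = int r * a\<^sup>2)"
    by blast
  from choice[OF this] show ?thesis by blast
qed

end
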